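(* (Soundness for Sequents.) If $\vdash\Gamma\Rightarrow\Delta$ in $\mathbf{CPF}^I$, then $\vDash\Gamma\Rightarrow\Delta$, i.e. for every structure $\mathfrak{A}$ and every $s\colon V\to|\mathfrak{A}|$: if $\mathfrak{A}$ satisfies every member of $\Gamma$ with $s$, then $\mathfrak{A}$ satisfies some member of $\Delta$ with $s$.
   Context: Language $\mathcal{L}$: first-order, with variables $V$ (which may occur free), individual constants, function symbols, predicate symbols, identity $=$, a one-place existence predicate $\exists!$, connectives $\neg,\rightarrow$, quantifier $\forall$, and the binary quantifier $I$: if $A,B$ are formulas and $x$ a variable, $Ix[A,B]$ is a formula binding $x$ in $A$ and $B$. $A_t^x$ is substitution of $t$ for $x$ ($t$ free for $x$). Sequents $\Gamma\Rightarrow\Delta$ have finite sets of formulas on each side. The system $\mathbf{CPF}^I$ has axioms $A\Rightarrow A$ and the rules: Cut; weakening and contraction; $(L\neg)$: $\Gamma\Rightarrow\Delta,A$ / $\neg A,\Gamma\Rightarrow\Delta$; $(R\neg)$: $A,\Gamma\Rightarrow\Delta$ / $\Gamma\Rightarrow\Delta,\neg A$; $(L\rightarrow)$: $\Gamma\Rightarrow\Delta,A$ and $B,\Gamma\Rightarrow\Delta$ / $A\rightarrow B,\Gamma\Rightarrow\Delta$; $(R\rightarrow)$: $A,\Gamma\Rightarrow\Delta,B$ / $\Gamma\Rightarrow\Delta,A\rightarrow B$; $(L\forall)$: $A_t^x,\Gamma\Rightarrow\Delta$ / $\exists!t,\forall xA,\Gamma\Rightarrow\Delta$; $(R\forall)$: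 $\exists!a,\Gamma\Rightarrow\Delta,A_a^x$ / $\Gamma\Rightarrow\Delta,\forall xA$; identity: $A_{t_2}^x,\Gamma\Rightarrow\Delta$ / $t_1=t_2,A_{t_1}^x,\Gamma\Rightarrow\Delta$ ($A$ atomic), and $t=t,\Gamma\Rightarrow\Delta$ / $\Gamma\Rightarrow\Delta$; $(RI)$: $\Gamma\Rightarrow\Delta,A_t^x$, $\Gamma\Rightarrow\Delta,B_t^x$, $A_a^x,\Gamma\Rightarrow\Delta,a=t$ / $\Gamma\Rightarrow\Delta,Ix[A,B]$; $(LI^1)$: $A_a^x,B_a^x,\Gamma\Rightarrow\Delta$ / $Ix[A,B],\Gamma\Rightarrow\Delta$; $(LI^2)$: $\Gamma\Rightarrow\Delta,A_{t_1}^x$, $\Gamma\Rightarrow\Delta,A_{t_2}^x$, $\Gamma\Rightarrow\Delta,C_{t_2}^x$ / $Ix[A,B],\Gamma\Rightarrow\Delta,C_{t_1}^x$ ($C$ atomic). In $(R\forall)$, $(RI)$, $(LI^1)$ the eigen-term $a$ (a variable or constant) must not occur in the conclusion. A structure $\mathfrak{A}$ consists of a non-empty domain $|\mathfrak{A}|$, an inner domain $|\mathfrak{A}^\forall|\subseteq|\mathfrak{A}|$ (possibly empty), which is also the interpretation of $\exists!$, relations $P^\mathfrak{A}\subseteq|\mathfrak{A}|^n$, elements $c^\mathfrak{A}\in|\mathfrak{A}|$, and operations $f^\mathfrak{A}\colon|\mathfrak{A}|^n\to|\mathfrak{A}|$. For $s\colon V\to|\mathfrak{A}|$, $\overline{s}$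 is its usual extension to terms, and $s(x|d)$ is $s$ modified to send $x$ to $d$. Satisfaction: $\vDash_\mathfrak{A}t_1=t_2[s]$ iff $\overline{s}(t_1)=\overline{s}(t_2)$; $\vDash_\mathfrak{A}\exists!t[s]$ iff $\overline{s}(t)\in|\mathfrak{A}^\forall|$; $\vDash_\mathfrak{A}Pt_1\dots t_n[s]$ iff $\langle\overline{s}(t_1),\dots,\overline{s}(t_n)\rangle\in P^\mathfrak{A}$; $\neg$ and $\rightarrow$ classically; $\vDash_\mathfrak{A}\forall xA[s]$ iff $\vDash_\mathfrak{A}A[s(x|d)]$ for every $d\in|\mathfrak{A}^\forall|$; $\vDash_\mathfrak{A}Ix[A,B][s]$ iff there is $d\in|\mathfrak{A}|$ with $\vDash_\mathfrak{A}A[s(x|d)]$, no other $e\in|\mathfrak{A}|$ with $\vDash_\mathfrak{A}A[s(x|e)]$, and $\vDash_\mathfrak{A}B[s(x|d)]$.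
   Formalization: In rule (RI) the eigen-term a is additionally required not to occur in t; otherwise, with t = a and A = B = (x = x), the rule would derive ⇒ Ix[x=x, x=x], which fails in any structure with two elements. *)

theory Defs
  imports Main "HOL-Library.FSet"
begin

text \<open>Symbols of a language are the elements of types \<open>'c\<close> (individual constants), \<open>'f\<close> (function
  symbols) and \<open>'p\<close> (predicate symbols). The arities are kept in a signature, and the terms and
  formulas of the language are those for which \<open>wf_tm\<close> and \<open>wf_fm\<close> hold.\<close>

type_synonym var = nat

record ('f, 'p) sig =
  fun_arity :: "'f \<Rightarrow> nat"
  pred_arity :: "'p \<Rightarrow> nat"

datatype ('c, 'f) tm =
    Var var
  | Const 'c
  | Fun 'f "('c, 'f) tm list"

text \<open>\<open>Existent t\<close> is the atomic formula \<open>\<exists>!t\<close>, and \<open>Iota x A B\<close> is \<open>Ix[A,B]\<close>.\<close>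

datatype ('c, 'f, 'p) fm =
    Eq "('c, 'f) tm" "('c, 'f) tm"
  | Existent "('c, 'f) tm"
  | Pred 'p "('c, 'f) tm list"
  | Neg "('c, 'f, 'p) fm"
  | Imp "('c, 'f, 'p) fm" "('c, 'f, 'p) fm"
  | Forall var "('c, 'f, 'p) fm"
  | Iota var "('c, 'f, 'p) fm" "('c, 'f, 'p) fm"

primrec wf_tm :: "('f, 'p) sig \<Rightarrow> ('c, 'f) tm \<Rightarrow> bool" where
  "wf_tm S (Var x) \<longleftrightarrow> True"
| "wf_tm S (Const c) \<longleftrightarrow> True"
| "wf_tm S (Fun f ts) \<longleftrightarrow> length ts = fun_arity S f \<and> list_all (wf_tm S) ts"

primrec wf_fm :: "('f, 'p) sig \<Rightarrow> ('c, 'f, 'p) fm \<Rightarrow> bool" where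
  "wf_fm S (Eq t u) \<longleftrightarrow> wf_tm S t \<and> wf_tm S u"
| "wf_fm S (Existent t) \<longleftrightarrow> wf_tm S t"
| "wf_fm S (Pred P ts) \<longleftrightarrow> length ts = pred_arity S P \<and> list_all (wf_tm S) ts"
| "wf_fm S (Neg A) \<longleftrightarrow> wf_fm S A"
| "wf_fm S (Imp A B) \<longleftrightarrow> wf_fm S A \<and> wf_fm S B"
| "wf_fm S (Forall x A) \<longleftrightarrow> wf_fm S A"
| "wf_fm S (Iota x A B) \<longleftrightarrow> wf_fm S A \<and> wf_fm S B"

primrec atomic :: "('c, 'f, 'p) fm \<Rightarrow> bool" where
  "atomic (Eq t u) \<longleftrightarrow> True"
| "atomic (Existent t) \<longleftrightarrow> True"
| "atomic (Pred P ts) \<longleftrightarrow> True"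
| "atomic (Neg A) \<longleftrightarrow> False"
| "atomic (Imp A B) \<longleftrightarrow> False"
| "atomic (Forall x A) \<longleftrightarrow> False"
| "atomic (Iota x A B) \<longleftrightarrow> False"

text \<open>The variables and constants occurring in an expression. Bound occurrences of a variable, and
  its occurrence next to a quantifier, count.\<close>

primrec params_tm :: "('c, 'f) tm \<Rightarrow> ('c, 'f) tm set" where
  "params_tm (Var x) = {Var x}"
| "params_tm (Const c) = {Const c}"
| "params_tm (Fun f ts) = \<Union> (set (map params_tm ts))"

primrec params_fm :: "('c, 'f, 'p) fm \<Rightarrow> ('c, 'f) tm set" where
  "params_fm (Eq t u) = params_tm t \<union> params_tm u"
| "params_fm (Existent t) = params_tm t"
| "params_fm (Pred P ts) = \<Union> (set (map params_tm ts))"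
| "params_fm (Neg A) = params_fm A"
| "params_fm (Imp A B) = params_fm A \<union> params_fm B"
| "params_fm (Forall x A) = insert (Var x) (params_fm A)"
| "params_fm (Iota x A B) = insert (Var x) (params_fm A \<union> params_fm B)"

definition params_fms :: "('c, 'f, 'p) fm fset \<Rightarrow> ('c, 'f) tm set" where
  "params_fms \<Gamma> = (\<Union>A \<in> fset \<Gamma>. params_fm A)"

definition eigen_term :: "('c, 'f) tm \<Rightarrow> bool" where
  "eigen_term a \<longleftrightarrow> a \<in> range Var \<union> range Const"

definition vars_tm :: "('c, 'f) tm \<Rightarrow> var set" where
  "vars_tm t = {x. Var x \<in> params_tm t}"

primrec fv :: "('c, 'f, 'p) fm \<Rightarrow> var set" where
  "fv (Eq t u) = vars_tm t \<union> vars_tm u"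
| "fv (Existent t) = vars_tm t"
| "fv (Pred P ts) = \<Union> (set (map vars_tm ts))"
| "fv (Neg A) = fv A"
| "fv (Imp A B) = fv A \<union> fv B"
| "fv (Forall x A) = fv A - {x}"
| "fv (Iota x A B) = (fv A \<union> fv B) - {x}"

text \<open>Substitution replaces the free occurrences without renaming bound variables, so it is only
  meaningful under the proviso \<open>free_for t x A\<close>.\<close>

primrec subst_tm :: "('c, 'f) tm \<Rightarrow> var \<Rightarrow> ('c, 'f) tm \<Rightarrow> ('c, 'f) tm" where
  "subst_tm (Var y) x t = (if y = x then t else Var y)"
| "subst_tm (Const c) x t = Const c"
| "subst_tm (Fun f us) x t = Fun f (map (\<lambda>u. subst_tm u x t) us)"

primrec subst :: "('c, 'f, 'p) fm \<Rightarrow> var \<Rightarrow> ('c, 'f) tm \<Rightarrow> ('c, 'f, 'p) fm" where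
  "subst (Eq u v) x t = Eq (subst_tm u x t) (subst_tm v x t)"
| "subst (Existent u) x t = Existent (subst_tm u x t)"
| "subst (Pred P us) x t = Pred P (map (\<lambda>u. subst_tm u x t) us)"
| "subst (Neg A) x t = Neg (subst A x t)"
| "subst (Imp A B) x t = Imp (subst A x t) (subst B x t)"
| "subst (Forall y A) x t = (if y = x then Forall y A else Forall y (subst A x t))"
| "subst (Iota y A B) x t = (if y = x then Iota y A B else Iota y (subst A x t) (subst B x t))"

primrec free_for :: "('c, 'f) tm \<Rightarrow> var \<Rightarrow> ('c, 'f, 'p) fm \<Rightarrow> bool" where
  "free_for t x (Eq u v) \<longleftrightarrow> True"
| "free_for t x (Existent u) \<longleftrightarrow> True"
| "free_for t x (Pred P us) \<longleftrightarrow> True"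
| "free_for t x (Neg A) \<longleftrightarrow> free_for t x A"
| "free_for t x (Imp A B) \<longleftrightarrow> free_for t x A \<and> free_for t x B"
| "free_for t x (Forall y A) \<longleftrightarrow> x \<notin> fv (Forall y A) \<or> y \<notin> vars_tm t \<and> free_for t x A"
| "free_for t x (Iota y A B) \<longleftrightarrow>
     x \<notin> fv (Iota y A B) \<or> y \<notin> vars_tm t \<and> free_for t x A \<and> free_for t x B"

text \<open>\<open>S \<turnstile> \<Gamma> \<triangleright> \<Delta>\<close> means that the sequent \<open>\<Gamma> \<Rightarrow> \<Delta>\<close> is derivable in \<open>CPF\<^sup>I\<close> over the signature \<open>S\<close>.

  The eigen-term \<open>a\<close> of \<open>RI\<close> has to be distinct from the parameters of \<open>t\<close>, although \<open>t\<close> is not part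
  of the conclusion: with \<open>a\<close> for \<open>t\<close> the third premise would be trivial, and
  \<open>\<Rightarrow> Ix[x = x, x = x]\<close> would be derivable.

  Every term is free for \<open>x\<close> in an atomic formula, so the substitutions in \<open>EqL\<close>, and those into \<open>C\<close>
  in \<open>LI2\<close>, need no such proviso. The contraction rules are vacuous for sets.\<close>

inductive cpfi ::
  "('f, 'p) sig \<Rightarrow> ('c, 'f, 'p) fm fset \<Rightarrow> ('c, 'f, 'p) fm fset \<Rightarrow> bool"
  ("_ \<turnstile> _ \<triangleright> _" [51, 51, 51] 50)
  for S :: "('f, 'p) sig"
where
  Ax: "wf_fm S A \<Longrightarrow> S \<turnstile> {|A|} \<triangleright> {|A|}"
| Cut: "\<lbrakk>S \<turnstile> \<Gamma> \<triangleright> finsert A \<Delta>; S \<turnstile> finsert A \<Theta> \<triangleright> \<Lambda>\<rbrakk> \<Longrightarrow> S \<turnstile> \<Gamma> |\<union>| \<Theta> \<triangleright> \<Delta> |\<union>| \<Lambda>"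
| LW: "\<lbrakk>wf_fm S A; S \<turnstile> \<Gamma> \<triangleright> \<Delta>\<rbrakk> \<Longrightarrow> S \<turnstile> finsert A \<Gamma> \<triangleright> \<Delta>"
| RW: "\<lbrakk>wf_fm S A; S \<turnstile> \<Gamma> \<triangleright> \<Delta>\<rbrakk> \<Longrightarrow> S \<turnstile> \<Gamma> \<triangleright> finsert A \<Delta>"
| LC: "S \<turnstile> finsert A (finsert A \<Gamma>) \<triangleright> \<Delta> \<Longrightarrow> S \<turnstile> finsert A \<Gamma> \<triangleright> \<Delta>"
| RC: "S \<turnstile> \<Gamma> \<triangleright> finsert A (finsert A \<Delta>) \<Longrightarrow> S \<turnstile> \<Gamma> \<triangleright> finsert A \<Delta>"
| LNeg: "S \<turnstile> \<Gamma> \<triangleright> finsert A \<Delta> \<Longrightarrow> S \<turnstile> finsert (Neg A) \<Gamma> \<triangleright> \<Delta>"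
| RNeg: "S \<turnstile> finsert A \<Gamma> \<triangleright> \<Delta> \<Longrightarrow> S \<turnstile> \<Gamma> \<triangleright> finsert (Neg A) \<Delta>"
| LImp: "\<lbrakk>S \<turnstile> \<Gamma> \<triangleright> finsert A \<Delta>; S \<turnstile> finsert B \<Gamma> \<triangleright> \<Delta>\<rbrakk> \<Longrightarrow> S \<turnstile> finsert (Imp A B) \<Gamma> \<triangleright> \<Delta>"
| RImp: "S \<turnstile> finsert A \<Gamma> \<triangleright> finsert B \<Delta> \<Longrightarrow> S \<turnstile> \<Gamma> \<triangleright> finsert (Imp A B) \<Delta>"
| LAll: "\<lbrakk>wf_fm S A; wf_tm S t; free_for t x A; S \<turnstile> finsert (subst A x t) \<Gamma> \<triangleright> \<Delta>\<rbrakk>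
    \<Longrightarrow> S \<turnstile> finsert (Existent t) (finsert (Forall x A) \<Gamma>) \<triangleright> \<Delta>"
| RAll: "\<lbrakk>wf_fm S A; eigen_term a; free_for a x A;
     a \<notin> params_fms (\<Gamma> |\<union>| finsert (Forall x A) \<Delta>);
     S \<turnstile> finsert (Existent a) \<Gamma> \<triangleright> finsert (subst A x a) \<Delta>\<rbrakk>
    \<Longrightarrow> S \<turnstile> \<Gamma> \<triangleright> finsert (Forall x A) \<Delta>"
| EqL: "\<lbrakk>wf_fm S A; atomic A; wf_tm S t1; wf_tm S t2; S \<turnstile> finsert (subst A x t2) \<Gamma> \<triangleright> \<Delta>\<rbrakk>
    \<Longrightarrow> S \<turnstile> finsert (Eq t1 t2) (finsert (subst A x t1) \<Gamma>) \<triangleright> \<Delta>"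
| EqRefl: "\<lbrakk>wf_tm S t; S \<turnstile> finsert (Eq t t) \<Gamma> \<triangleright> \<Delta>\<rbrakk> \<Longrightarrow> S \<turnstile> \<Gamma> \<triangleright> \<Delta>"
| RI: "\<lbrakk>wf_fm S A; wf_fm S B; wf_tm S t; free_for t x A; free_for t x B;
     eigen_term a; free_for a x A;
     a \<notin> params_fms (\<Gamma> |\<union>| finsert (Iota x A B) \<Delta>); a \<notin> params_tm t;
     S \<turnstile> \<Gamma> \<triangleright> finsert (subst A x t) \<Delta>; S \<turnstile> \<Gamma> \<triangleright> finsert (subst B x t) \<Delta>;
     S \<turnstile> finsert (subst A x a) \<Gamma> \<triangleright> finsert (Eq a t) \<Delta>\<rbrakk>
    \<Longrightarrow> S \<turnstile> \<Gamma> \<triangleright> finsert (Iota x A B) \<Delta>"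
| LI1: "\<lbrakk>wf_fm S A; wf_fm S B; eigen_term a; free_for a x A; free_for a x B;
     a \<notin> params_fms (finsert (Iota x A B) \<Gamma> |\<union>| \<Delta>);
     S \<turnstile> finsert (subst A x a) (finsert (subst B x a) \<Gamma>) \<triangleright> \<Delta>\<rbrakk>
    \<Longrightarrow> S \<turnstile> finsert (Iota x A B) \<Gamma> \<triangleright> \<Delta>"
| LI2: "\<lbrakk>wf_fm S A; wf_fm S B; wf_fm S C; atomic C; wf_tm S t1; wf_tm S t2;
     free_for t1 x A; free_for t2 x A;
     S \<turnstile> \<Gamma> \<triangleright> finsert (subst A x t1) \<Delta>; S \<turnstile> \<Gamma> \<triangleright> finsert (subst A x t2) \<Delta>;
     S \<turnstile> \<Gamma> \<triangleright> finsert (subst C x t2) \<Delta>\<rbrakk>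
    \<Longrightarrow> S \<turnstile> finsert (Iota x A B) \<Gamma> \<triangleright> finsert (subst C x t1) \<Delta>"

record ('c, 'f, 'p, 'd) struc =
  domain_of :: "'d set"
  inner_of :: "'d set"
  const_of :: "'c \<Rightarrow> 'd"
  fun_of :: "'f \<Rightarrow> 'd list \<Rightarrow> 'd"
  rel_of :: "'p \<Rightarrow> 'd list set"

text \<open>The values of \<open>fun_of\<close> outside of \<open>|\<AA>|\<^sup>n\<close> are irrelevant.\<close>

definition is_struc :: "('f, 'p) sig \<Rightarrow> ('c, 'f, 'p, 'd) struc \<Rightarrow> bool" where
  "is_struc S \<AA> \<longleftrightarrow>
     domain_of \<AA> \<noteq> {} \<and> inner_of \<AA> \<subseteq> domain_of \<AA> \<and>
     (\<forall>c. const_of \<AA> c \<in> domain_of \<AA>) \<and>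
     (\<forall>f ds. set ds \<subseteq> domain_of \<AA> \<and> length ds = fun_arity S f \<longrightarrow> fun_of \<AA> f ds \<in> domain_of \<AA>) \<and>
     (\<forall>P. rel_of \<AA> P \<subseteq> {ds. set ds \<subseteq> domain_of \<AA> \<and> length ds = pred_arity S P})"

primrec val :: "('c, 'f, 'p, 'd) struc \<Rightarrow> (var \<Rightarrow> 'd) \<Rightarrow> ('c, 'f) tm \<Rightarrow> 'd" where
  "val \<AA> s (Var x) = s x"
| "val \<AA> s (Const c) = const_of \<AA> c"
| "val \<AA> s (Fun f ts) = fun_of \<AA> f (map (val \<AA> s) ts)"

primrec sat :: "('c, 'f, 'p, 'd) struc \<Rightarrow> (var \<Rightarrow> 'd) \<Rightarrow> ('c, 'f, 'p) fm \<Rightarrow> bool" where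
  "sat \<AA> s (Eq t u) \<longleftrightarrow> val \<AA> s t = val \<AA> s u"
| "sat \<AA> s (Existent t) \<longleftrightarrow> val \<AA> s t \<in> inner_of \<AA>"
| "sat \<AA> s (Pred P ts) \<longleftrightarrow> map (val \<AA> s) ts \<in> rel_of \<AA> P"
| "sat \<AA> s (Neg A) \<longleftrightarrow> \<not> sat \<AA> s A"
| "sat \<AA> s (Imp A B) \<longleftrightarrow> (sat \<AA> s A \<longrightarrow> sat \<AA> s B)"
| "sat \<AA> s (Forall x A) \<longleftrightarrow> (\<forall>d \<in> inner_of \<AA>. sat \<AA> (s(x := d)) A)"
| "sat \<AA> s (Iota x A B) \<longleftrightarrow>
     (\<exists>d \<in> domain_of \<AA>. sat \<AA> (s(x := d)) A \<and>
        \<not> (\<exists>e \<in> domain_of \<AA>. e \<noteq> d \<and> sat \<AA> (s(x := e)) A) \<and> sat \<AA> (s(x := d)) B)"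

end

theory Submission imports Defs begin

text \<open>Induction on derivations. The rules with an eigen-term \<open>a\<close> are sound because \<open>a\<close> can be made to
  denote any element \<open>d\<close> of the domain without affecting expressions in which it does not occur: if \<open>a\<close>
  is a variable the assignment is changed, and if it is a constant the structure is. As the
  induction hypothesis is about all structures and assignments, it applies to the changed ones.\<close>

section \<open>Coincidence of values and of satisfaction\<close>

lemma val_cong:
  assumes "fun_of \<AA> = fun_of \<BB>" "\<And>y. y \<in> vars_tm t \<Longrightarrow> s y = r y"
    "\<And>c. Const c \<in> params_tm t \<Longrightarrow> const_of \<AA> c = const_of \<BB> c"
  shows "val \<AA> s t = val \<BB> r t"
  using assms
proof (induction t)
  case (Fun f ts)
  have "map (val \<AA> s) ts = map (val \<BB> r) ts"
  proof (rule map_cong[OF refl])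
    fix u assume u: "u \<in> set ts"
    show "val \<AA> s u = val \<BB> r u"
      by (rule Fun.IH[OF u]) (use u Fun.prems in \<open>auto simp: vars_tm_def\<close>)
  qed
  then show ?case using Fun.prems(1) by (simp del: map_eq_conv)
qed (auto simp: vars_tm_def)

lemma vals_cong:
  assumes "fun_of \<AA> = fun_of \<BB>" "\<And>y. y \<in> \<Union> (vars_tm ` set ts) \<Longrightarrow> s y = r y"
    "\<And>c. Const c \<in> \<Union> (params_tm ` set ts) \<Longrightarrow> const_of \<AA> c = const_of \<BB> c"
  shows "map (val \<AA> s) ts = map (val \<BB> r) ts"
  by (rule map_cong[OF refl], rule val_cong) (use assms in auto)

text \<open>Satisfaction consults the assignment only at free variables. The structures are allowed
  to differ on constants because an eigen-constant will be reinterpreted.\<close>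

lemma sat_cong:
  assumes "domain_of \<AA> = domain_of \<BB>" "inner_of \<AA> = inner_of \<BB>" "fun_of \<AA> = fun_of \<BB>"
    "rel_of \<AA> = rel_of \<BB>" "\<And>y. y \<in> fv A \<Longrightarrow> s y = r y"
    "\<And>c. Const c \<in> params_fm A \<Longrightarrow> const_of \<AA> c = const_of \<BB> c"
  shows "sat \<AA> s A \<longleftrightarrow> sat \<BB> r A"
  using assms
proof (induction A arbitrary: s r)
  case (Eq t u)
  have "val \<AA> s t = val \<BB> r t" "val \<AA> s u = val \<BB> r u"
    by (rule val_cong; use Eq in auto)+
  then show ?case by simp
next
  case (Existent t)
  have "val \<AA> s t = val \<BB> r t"
    by (rule val_cong; use Existent in auto)
  then show ?case using Existent by simp
next
  case (Pred P ts)
  have "map (val \<AA> s) ts = map (val \<BB> r) ts"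
    by (rule vals_cong; use Pred in auto)
  then show ?case using Pred.prems(4) by (simp del: map_eq_conv)
next
  case (Neg A)
  then show ?case by simp
next
  case (Imp A B)
  have "sat \<AA> s A \<longleftrightarrow> sat \<BB> r A" "sat \<AA> s B \<longleftrightarrow> sat \<BB> r B"
    by (rule Imp.IH; use Imp.prems in auto)+
  then show ?case by simp
next
  case (Forall x A)
  \<comment> \<open>Both updated assignments send \<open>x\<close> to \<open>d\<close>, so agreement
    on \<open>fv (Forall x A)\<close> extends to \<open>fv A\<close>.\<close>
  have "sat \<AA> (s(x := d)) A \<longleftrightarrow> sat \<BB> (r(x := d)) A" for d
    by (rule Forall.IH; use Forall.prems in auto)
  then show ?case using Forall.prems(2) by simp
next
  case (Iota x A B)
  have "sat \<AA> (s(x := d)) A \<longleftrightarrow> sat \<BB> (r(x := d)) A"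
    "sat \<AA> (s(x := d)) B \<longleftrightarrow> sat \<BB> (r(x := d)) B" for d
    by (rule Iota.IH; use Iota.prems in auto)+
  then show ?case using Iota.prems(1) by simp
qed

text \<open>Links the freshness conditions of the rules, which count bound occurrences too, to
  \<open>sat_cong\<close>, which asks about free variables.\<close>

lemma fv_subset_params: "y \<in> fv A \<Longrightarrow> Var y \<in> params_fm A"
  by (induction A) (auto simp: vars_tm_def)

text \<open>The quantifier \<open>I\<close> ranges over the domain, not over the whole type, so a
  term can supply a witness only if its value lies there. Wellformedness enters since
  \<open>fun_of\<close> is constrained only on lists of the right length.\<close>

lemma val_in_domain:
  assumes "is_struc S \<AA>" "\<And>x. s x \<in> domain_of \<AA>" "wf_tm S t"
  shows "val \<AA> s t \<in> domain_of \<AA>"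
  using assms(3)
proof (induction t)
  case (Fun f ts)
  then have "set (map (val \<AA> s) ts) \<subseteq> domain_of \<AA>" "length (map (val \<AA> s) ts) = fun_arity S f"
    by (auto simp: list_all_iff)
  then show ?case using assms(1) unfolding is_struc_def by simp
qed (use assms in \<open>auto simp: is_struc_def\<close>)

section \<open>Substitution as a change of assignment\<close>

lemma val_subst_tm: "val \<AA> s (subst_tm u x t) = val \<AA> (s(x := val \<AA> s t)) u"
  by (induction u) (auto cong: map_cong simp: comp_def)

lemma subst_tm_notin: "x \<notin> vars_tm u \<Longrightarrow> subst_tm u x t = u"
  by (induction u) (auto simp: vars_tm_def intro: map_idI)

lemma subst_notin: "x \<notin> fv A \<Longrightarrow> subst A x t = A"
  by (induction A) (auto simp: subst_tm_notin intro: map_idI)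

lemma val_fun_upd_notin: "y \<notin> vars_tm t \<Longrightarrow> val \<AA> (s(y := d)) t = val \<AA> s t"
  by (rule val_cong) auto

lemma sat_fun_upd_notin: "y \<notin> fv A \<Longrightarrow> sat \<AA> (s(y := d)) A = sat \<AA> s A"
  by (rule sat_cong) auto

text \<open>On the left, \<open>t\<close> is evaluated under the assignment in force at each free
  occurrence of \<open>x\<close>; on the right, under the outer \<open>s\<close>. The values agree
  because \<open>free_for\<close> lets no quantifier above such an occurrence bind a variable of
  \<open>t\<close>.\<close>

lemma sat_subst:
  "free_for t x A \<Longrightarrow> sat \<AA> s (subst A x t) \<longleftrightarrow> sat \<AA> (s(x := val \<AA> s t)) A"
proof (induction A arbitrary: s)
  case (Pred P ts)
  have "map (val \<AA> s) (map (\<lambda>u. subst_tm u x t) ts) = map (val \<AA> (s(x := val \<AA> s t))) ts"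
    by (simp add: val_subst_tm)
  then show ?case by (simp only: subst.simps sat.simps)
next
  case (Forall y A)
  show ?case
  proof (cases "x \<in> fv (Forall y A)")
    case False
    \<comment> \<open>Here \<open>free_for\<close> says nothing about capture, but both sides reduce
      to \<open>sat \<AA> s (Forall y A)\<close>. This includes the case that \<open>y\<close> is
      \<open>x\<close>.\<close>
    show ?thesis by (simp only: subst_notin[OF False] sat_fun_upd_notin[OF False])
  next
    case True
    then have xy: "x \<noteq> y" "y \<notin> vars_tm t" "free_for t x A" using Forall.prems by auto
    \<comment> \<open>The induction hypothesis evaluates \<open>t\<close> under
      \<open>s(y := d)\<close>. As \<open>y\<close> is not in \<open>t\<close>, this is its value
      under \<open>s\<close>, and updates at distinct variables commute.\<close>
    have "sat \<AA> (s(y := d)) (subst A x t) \<longleftrightarrow> sat \<AA> (s(x := val \<AA> s t, y := d)) A" for d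
      using Forall.IH[OF xy(3), of "s(y := d)"]
      by (simp only: val_fun_upd_notin[OF xy(2)] fun_upd_twist[OF xy(1)])
    then show ?thesis by (simp only: subst.simps sat.simps if_not_P[OF xy(1)[symmetric]])
  qed
next
  case (Iota y A B)
  show ?case
  proof (cases "x \<in> fv (Iota y A B)")
    case False
    show ?thesis by (simp only: subst_notin[OF False] sat_fun_upd_notin[OF False])
  next
    case True
    then have xy: "x \<noteq> y" "y \<notin> vars_tm t" "free_for t x A" "free_for t x B"
      using Iota.prems by auto
    have "sat \<AA> (s(y := d)) (subst A x t) \<longleftrightarrow> sat \<AA> (s(x := val \<AA> s t, y := d)) A"
      "sat \<AA> (s(y := d)) (subst B x t) \<longleftrightarrow> sat \<AA> (s(x := val \<AA> s t, y := d)) B" for d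
      using Iota.IH(1)[OF xy(3), of "s(y := d)"] Iota.IH(2)[OF xy(4), of "s(y := d)"]
      by (simp_all only: val_fun_upd_notin[OF xy(2)] fun_upd_twist[OF xy(1)])
    then show ?thesis by (simp only: subst.simps sat.simps if_not_P[OF xy(1)[symmetric]])
  qed
qed (simp_all add: val_subst_tm)

lemma free_for_atomic: "atomic A \<Longrightarrow> free_for t x A"
  by (cases A) auto

section \<open>Eigen-terms\<close>

lemma eigen_variant:
  assumes "eigen_term a" "is_struc S \<AA>" "\<forall>x. s x \<in> domain_of \<AA>" "d \<in> domain_of \<AA>"
  obtains \<BB> r where "is_struc S \<BB>" "\<forall>x. r x \<in> domain_of \<BB>" "inner_of \<BB> = inner_of \<AA>"
    "val \<BB> r a = d"
    "\<And>t. a \<notin> params_tm t \<Longrightarrow> val \<BB> r t = val \<AA> s t"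
    "\<And>A. a \<notin> params_fm A \<Longrightarrow> sat \<BB> r A \<longleftrightarrow> sat \<AA> s A"
    "\<And>A x. a \<notin> params_fm A \<Longrightarrow> free_for a x A \<Longrightarrow>
       sat \<BB> r (subst A x a) \<longleftrightarrow> sat \<AA> (s(x := d)) A"
proof -
  \<comment> \<open>Only one of the two changes takes effect: \<open>\<BB>\<close> is
    \<open>\<AA>\<close> if \<open>a\<close> is a variable, and \<open>r\<close> is \<open>s\<close>
    if \<open>a\<close> is a constant.\<close>
  define \<BB> where "\<BB> = \<AA>\<lparr>const_of := \<lambda>c. if a = Const c then d else const_of \<AA> c\<rparr>"
  define r where "r = (\<lambda>x. if a = Var x then d else s x)"
  have val_a: "val \<BB> r a = d"
    using assms(1) by (auto simp: eigen_term_def \<BB>_def r_def)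
  have val_eq: "val \<BB> r t = val \<AA> s t" if "a \<notin> params_tm t" for t
    by (rule val_cong) (use that in \<open>auto simp: \<BB>_def r_def vars_tm_def\<close>)
  \<comment> \<open>This updated form is what \<open>sat \<BB> r (subst A x a)\<close> becomes under
    \<open>sat_subst\<close> and \<open>val_a\<close>.\<close>
  have sat_eq: "sat \<BB> (r(x := e)) A \<longleftrightarrow> sat \<AA> (s(x := e)) A" if "a \<notin> params_fm A" for A x e
    by (rule sat_cong) (use that fv_subset_params in \<open>auto simp: \<BB>_def r_def\<close>)
  have sat_eq': "sat \<BB> r A \<longleftrightarrow> sat \<AA> s A" if "a \<notin> params_fm A" for A
    by (rule sat_cong) (use that fv_subset_params in \<open>auto simp: \<BB>_def r_def\<close>)
  show thesis
  proof (rule that[OF _ _ _ val_a val_eq sat_eq'])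
    show "is_struc S \<BB>" using assms(2,4) by (auto simp: is_struc_def \<BB>_def)
    show "\<forall>x. r x \<in> domain_of \<BB>" using assms(3,4) by (simp add: r_def \<BB>_def)
    show "inner_of \<BB> = inner_of \<AA>" by (simp add: \<BB>_def)
    show "sat \<BB> r (subst A x a) \<longleftrightarrow> sat \<AA> (s(x := d)) A"
      if "a \<notin> params_fm A" "free_for a x A" for A x
      using that by (simp add: sat_subst val_a sat_eq)
  qed
qed

section \<open>Soundness, rule by rule\<close>

theorem theorem2:
  fixes S :: "('f, 'p) sig" and \<Gamma> \<Delta> :: "('c, 'f, 'p) fm fset"
  assumes "S \<turnstile> \<Gamma> \<triangleright> \<Delta>"
  shows "\<forall>(\<AA> :: ('c, 'f, 'p, 'd) struc) s.
    is_struc S \<AA> \<and> (\<forall>x. s x \<in> domain_of \<AA>) \<longrightarrow>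
    (\<forall>A \<in> fset \<Gamma>. sat \<AA> s A) \<longrightarrow> (\<exists>B \<in> fset \<Delta>. sat \<AA> s B)"
  using assms
proof (induction rule: cpfi.induct)
  case (Cut \<Gamma> A \<Delta> \<Theta> \<Lambda>)
  show ?case
  proof (intro allI impI, elim conjE)
    fix \<AA> :: "('c, 'f, 'p, 'd) struc" and s
    assume st: "is_struc S \<AA>" "\<forall>x. s x \<in> domain_of \<AA>"
      and sat: "\<forall>B\<in>fset (\<Gamma> |\<union>| \<Theta>). sat \<AA> s B"
    have "\<exists>B\<in>fset (finsert A \<Delta>). sat \<AA> s B" using Cut.IH(1) st sat by simp
    moreover have "\<exists>B\<in>fset \<Lambda>. sat \<AA> s B" if "sat \<AA> s A"
      using Cut.IH(2) st sat that by simp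
    ultimately show "\<exists>B\<in>fset (\<Delta> |\<union>| \<Lambda>). sat \<AA> s B" by auto
  qed
next
  case (LAll A t x \<Gamma> \<Delta>)
  show ?case
  proof (intro allI impI, elim conjE)
    fix \<AA> :: "('c, 'f, 'p, 'd) struc" and s
    assume st: "is_struc S \<AA>" "\<forall>x. s x \<in> domain_of \<AA>"
      and sat: "\<forall>B\<in>fset (finsert (Existent t) (finsert (Forall x A) \<Gamma>)). sat \<AA> s B"
    \<comment> \<open>\<open>Existent t\<close> places the value of \<open>t\<close> in the inner
      domain, over which \<open>Forall\<close> ranges.\<close>
    then have "sat \<AA> s (subst A x t)" by (simp add: sat_subst[OF LAll(3)])
    then show "\<exists>B\<in>fset \<Delta>. sat \<AA> s B" using LAll.IH st sat by simp
  qed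
next
  case (RAll A a x \<Gamma> \<Delta>)
  show ?case
  proof (intro allI impI, elim conjE)
    fix \<AA> :: "('c, 'f, 'p, 'd) struc" and s
    assume st: "is_struc S \<AA>" "\<forall>x. s x \<in> domain_of \<AA>" and sat: "\<forall>B\<in>fset \<Gamma>. sat \<AA> s B"
    have "sat \<AA> (s(x := d)) A" if "\<not> (\<exists>B\<in>fset \<Delta>. sat \<AA> s B)" and d: "d \<in> inner_of \<AA>" for d
    proof -
      have dom: "d \<in> domain_of \<AA>" using st d by (auto simp: is_struc_def)
      obtain \<BB> r where *: "is_struc S \<BB>" "\<forall>x. r x \<in> domain_of \<BB>" "inner_of \<BB> = inner_of \<AA>"
        "val \<BB> r a = d"
        "\<And>t. a \<notin> params_tm t \<Longrightarrow> val \<BB> r t = val \<AA> s t"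
        "\<And>A. a \<notin> params_fm A \<Longrightarrow> sat \<BB> r A \<longleftrightarrow> sat \<AA> s A"
        "\<And>A x. a \<notin> params_fm A \<Longrightarrow> free_for a x A \<Longrightarrow>
           sat \<BB> r (subst A x a) \<longleftrightarrow> sat \<AA> (s(x := d)) A"
        by (rule eigen_variant[OF RAll(2) st(1) st(2) dom], rule that) blast+
      have fresh: "a \<notin> params_fm A" "\<And>B. B \<in> fset \<Gamma> \<union> fset \<Delta> \<Longrightarrow> a \<notin> params_fm B"
        using RAll(4) by (auto simp: params_fms_def)
      \<comment> \<open>\<open>Existent a\<close> holds in the variant because \<open>a\<close>
        denotes \<open>d\<close> and the inner domain is unchanged.\<close>
      have "\<forall>B\<in>fset (finsert (Existent a) \<Gamma>). sat \<BB> r B"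
        using sat fresh *(3,4,6) d by simp
      then have "\<exists>B\<in>fset (finsert (subst A x a) \<Delta>). sat \<BB> r B"
        by (rule RAll.IH[THEN spec, THEN spec, THEN mp, OF conjI[OF *(1,2)], THEN mp])
      \<comment> \<open>Freshness carries the failure of \<open>\<Delta>\<close> over to the
        variant, so the instance of \<open>A\<close> must be what holds.\<close>
      moreover have "\<not> (\<exists>B\<in>fset \<Delta>. sat \<BB> r B)"
        using that(1) fresh *(6) by auto
      ultimately show ?thesis using *(7)[OF fresh(1) RAll(3)] by simp
    qed
    then show "\<exists>B\<in>fset (finsert (Forall x A) \<Delta>). sat \<AA> s B" by auto
  qed
next
  case (EqL A t1 t2 x \<Gamma> \<Delta>)
  show ?case
  proof (intro allI impI, elim conjE)
    fix \<AA> :: "('c, 'f, 'p, 'd) struc" and s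
    assume st: "is_struc S \<AA>" "\<forall>x. s x \<in> domain_of \<AA>"
      and sat: "\<forall>B\<in>fset (finsert (Eq t1 t2) (finsert (subst A x t1) \<Gamma>)). sat \<AA> s B"
    \<comment> \<open>Both instances amount to \<open>A\<close> under one assignment, as
      \<open>t1\<close> and \<open>t2\<close> have equal values.\<close>
    then have "sat \<AA> s (subst A x t2)"
      by (auto simp: sat_subst[OF free_for_atomic[OF EqL(2)]])
    then show "\<exists>B\<in>fset \<Delta>. sat \<AA> s B" using EqL.IH st sat by simp
  qed
next
  case (RI A B t x a \<Gamma> \<Delta>)
  show ?case
  proof (intro allI impI, elim conjE)
    fix \<AA> :: "('c, 'f, 'p, 'd) struc" and s
    assume st: "is_struc S \<AA>" "\<forall>x. s x \<in> domain_of \<AA>" and sat: "\<forall>B\<in>fset \<Gamma>. sat \<AA> s B"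
    have "sat \<AA> s (Iota x A B)" if no: "\<not> (\<exists>B\<in>fset \<Delta>. sat \<AA> s B)"
    proof -
      have "sat \<AA> s (subst A x t)" "sat \<AA> s (subst B x t)"
        using no RI.IH(1,2)[THEN spec, THEN spec, THEN mp, OF conjI[OF st], THEN mp, OF sat]
        by auto
      then have A: "sat \<AA> (s(x := val \<AA> s t)) A" and B: "sat \<AA> (s(x := val \<AA> s t)) B"
        using sat_subst RI(4,5) by blast+
      have dom: "val \<AA> s t \<in> domain_of \<AA>" using val_in_domain st RI(3) by blast
      \<comment> \<open>Uniqueness: \<open>a\<close> is made to denote the competitor
        \<open>e\<close>. Then \<open>Eq a t\<close> in the variant identifies \<open>e\<close> with
        the original value of \<open>t\<close>, which is preserved because \<open>a\<close> is not
        in \<open>t\<close>.\<close>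
      have "e = val \<AA> s t" if e: "e \<in> domain_of \<AA>" "sat \<AA> (s(x := e)) A" for e
      proof -
        obtain \<BB> r where *: "is_struc S \<BB>" "\<forall>x. r x \<in> domain_of \<BB>" "inner_of \<BB> = inner_of \<AA>"
          "val \<BB> r a = e"
          "\<And>t. a \<notin> params_tm t \<Longrightarrow> val \<BB> r t = val \<AA> s t"
          "\<And>A. a \<notin> params_fm A \<Longrightarrow> sat \<BB> r A \<longleftrightarrow> sat \<AA> s A"
          "\<And>A x. a \<notin> params_fm A \<Longrightarrow> free_for a x A \<Longrightarrow>
             sat \<BB> r (subst A x a) \<longleftrightarrow> sat \<AA> (s(x := e)) A"
          by (rule eigen_variant[OF RI(6) st(1) st(2) e(1)], rule that) blast+
        have fresh: "a \<notin> params_fm A" "\<And>B. B \<in> fset \<Gamma> \<union> fset \<Delta> \<Longrightarrow> a \<notin> params_fm B"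
          using RI(8) by (auto simp: params_fms_def)
        have "\<forall>B\<in>fset (finsert (subst A x a) \<Gamma>). sat \<BB> r B"
          using sat fresh *(6) *(7)[OF fresh(1) RI(7)] e(2) by simp
        then have "\<exists>B\<in>fset (finsert (Eq a t) \<Delta>). sat \<BB> r B"
          by (rule RI.IH(3)[THEN spec, THEN spec, THEN mp, OF conjI[OF *(1,2)], THEN mp])
        moreover have "\<not> (\<exists>B\<in>fset \<Delta>. sat \<BB> r B)"
          using no fresh *(6) by auto
        ultimately show ?thesis using *(4) *(5)[OF RI(9)] by simp
      qed
      then show ?thesis using A B dom unfolding sat.simps by blast
    qed
    then show "\<exists>B\<in>fset (finsert (Iota x A B) \<Delta>). sat \<AA> s B" by auto
  qed
next
  case (LI1 A B a x \<Gamma> \<Delta>)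
  show ?case
  proof (intro allI impI, elim conjE)
    fix \<AA> :: "('c, 'f, 'p, 'd) struc" and s
    assume st: "is_struc S \<AA>" "\<forall>x. s x \<in> domain_of \<AA>"
      and sat: "\<forall>B\<in>fset (finsert (Iota x A B) \<Gamma>). sat \<AA> s B"
    then obtain d where d: "d \<in> domain_of \<AA>" "sat \<AA> (s(x := d)) A" "sat \<AA> (s(x := d)) B"
      by auto
    \<comment> \<open>\<open>a\<close> is made to denote the described object \<open>d\<close>,
      which turns both instances in the premise true.\<close>
    obtain \<BB> r where *: "is_struc S \<BB>" "\<forall>x. r x \<in> domain_of \<BB>" "inner_of \<BB> = inner_of \<AA>"
      "val \<BB> r a = d"
      "\<And>t. a \<notin> params_tm t \<Longrightarrow> val \<BB> r t = val \<AA> s t"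
      "\<And>A. a \<notin> params_fm A \<Longrightarrow> sat \<BB> r A \<longleftrightarrow> sat \<AA> s A"
      "\<And>A x. a \<notin> params_fm A \<Longrightarrow> free_for a x A \<Longrightarrow>
         sat \<BB> r (subst A x a) \<longleftrightarrow> sat \<AA> (s(x := d)) A"
      by (rule eigen_variant[OF LI1(3) st(1) st(2) d(1)], rule that) blast+
    have fresh: "a \<notin> params_fm A" "a \<notin> params_fm B"
      "\<And>B. B \<in> fset \<Gamma> \<union> fset \<Delta> \<Longrightarrow> a \<notin> params_fm B"
      using LI1(6) by (auto simp: params_fms_def)
    have "\<forall>C\<in>fset (finsert (subst A x a) (finsert (subst B x a) \<Gamma>)). sat \<BB> r C"
      using sat fresh(3) *(6) *(7)[OF fresh(1) LI1(4)] *(7)[OF fresh(2) LI1(5)] d(2,3) by simp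
    then have "\<exists>B\<in>fset \<Delta>. sat \<BB> r B" by (rule LI1.IH[THEN spec, THEN spec, THEN mp, OF conjI[OF *(1,2)], THEN mp])
    then show "\<exists>B\<in>fset \<Delta>. sat \<AA> s B" using fresh(3) *(6) by auto
  qed
next
  case (LI2 A B C t1 t2 x \<Gamma> \<Delta>)
  show ?case
  proof (intro allI impI, elim conjE)
    fix \<AA> :: "('c, 'f, 'p, 'd) struc" and s
    assume st: "is_struc S \<AA>" "\<forall>x. s x \<in> domain_of \<AA>"
      and "\<forall>B\<in>fset (finsert (Iota x A B) \<Gamma>). sat \<AA> s B"
    then have iota: "sat \<AA> s (Iota x A B)" and sat: "\<forall>B\<in>fset \<Gamma>. sat \<AA> s B" by auto
    have "sat \<AA> s (subst C x t1)" if no: "\<not> (\<exists>B\<in>fset \<Delta>. sat \<AA> s B)"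
    proof -
      have "sat \<AA> s (subst A x t1)" "sat \<AA> s (subst A x t2)"
        and C: "sat \<AA> s (subst C x t2)"
        using no LI2.IH[THEN spec, THEN spec, THEN mp, OF conjI[OF st], THEN mp, OF sat]
        by auto
      then have A: "sat \<AA> (s(x := val \<AA> s t1)) A" "sat \<AA> (s(x := val \<AA> s t2)) A"
        using sat_subst LI2(7,8) by blast+
      have "val \<AA> s t1 \<in> domain_of \<AA>" "val \<AA> s t2 \<in> domain_of \<AA>"
        using val_in_domain st LI2(5,6) by blast+
      \<comment> \<open>Both values lie in the domain and satisfy \<open>A\<close>, so each is the
        unique object given by \<open>iota\<close>; hence \<open>C\<close> cannot tell
        \<open>t1\<close> from \<open>t2\<close>.\<close>
      then have "val \<AA> s t1 = val \<AA> s t2" using A iota unfolding sat.simps by metis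
      then show ?thesis using C by (simp add: sat_subst[OF free_for_atomic[OF LI2(4)]])
    qed
    then show "\<exists>B\<in>fset (finsert (subst C x t1) \<Delta>). sat \<AA> s B" by auto
  qed
\<comment> \<open>What remains are axioms, weakening, contraction, the rules for \<open>Neg\<close>
  and \<open>Imp\<close>, and \<open>EqRefl\<close>, all immediate from the truth
  conditions.\<close>
qed auto

end
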